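(* Let $Q$ be a quasiconvex subset of a hyperbolic group $G$ and let $H$ be a non-elementary subgroup of $G$. Assume, in addition, that $Q^{-1}\subset G$ is also quasiconvex. Then the following properties are equivalent: 1. for arbitrary finite subsets $P_1,P_2$ of $G$, $H\nsubseteq P_1QP_2$; 2. for arbitrary finite subsets $P_1,P_2$ of $G$, $H\nsubseteq P_1Q^{-1}QP_2$.
   Context: Hyperbolic means Gromov (word) hyperbolic. A group is elementary if it has a cyclic subgroup of finite index; otherwise it is non-elementary. Fix a finite symmetrized generating set of $G$. A subset of $G$ is quasiconvex if for some $\eta\ge0$ every geodesic segment in the Cayley graph of $G$ joining two elements of the subset lies in the closed $\eta$-neighborhood of the subset. For $A,B\subseteq G$, $AB=\{ab\mid a\in A,b\in B\}$ and $A^{-1}=\{a^{-1}\mid a\in A\}$. *)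

theory Defs
  imports Complex_Main "HOL-Algebra.Algebra"
begin

definition symmetrized_generating_set :: "('a, 'b) monoid_scheme \<Rightarrow> 'a set \<Rightarrow> bool" where
  "symmetrized_generating_set G S \<longleftrightarrow>
     finite S \<and> S \<subseteq> carrier G \<and> (\<forall>s\<in>S. inv\<^bsub>G\<^esub> s \<in> S) \<and> generate G S = carrier G"

definition cayley_edges :: "('a, 'b) monoid_scheme \<Rightarrow> 'a set \<Rightarrow> ('a \<times> 'a) set" where
  "cayley_edges G S = {(x, x \<otimes>\<^bsub>G\<^esub> s) | x s. x \<in> carrier G \<and> s \<in> S}"

(* Length of a shortest edge path. Only meaningful when x and y are group elements and
   S generates G, so that such a path exists. *)
definition cayley_dist :: "('a, 'b) monoid_scheme \<Rightarrow> 'a set \<Rightarrow> 'a \<Rightarrow> 'a \<Rightarrow> nat" where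
  "cayley_dist G S x y = (LEAST n. (x, y) \<in> cayley_edges G S ^^ n)"

(* A geodesic segment of length n joining two group elements, recorded by the vertices
   p 0, ..., p n it passes through; the values of p beyond n are irrelevant. *)
definition cayley_geodesic ::
  "('a, 'b) monoid_scheme \<Rightarrow> 'a set \<Rightarrow> (nat \<Rightarrow> 'a) \<Rightarrow> nat \<Rightarrow> bool" where
  "cayley_geodesic G S p n \<longleftrightarrow>
     (\<forall>i\<le>n. p i \<in> carrier G) \<and>
     (\<forall>j\<le>n. \<forall>i\<le>j. cayley_dist G S (p i) (p j) = j - i)"

(* Restricting to the vertices of a segment only changes the admissible eta by at most 1/2,
   since every point of an edge is within 1/2 of a vertex. *)
definition quasiconvex :: "('a, 'b) monoid_scheme \<Rightarrow> 'a set \<Rightarrow> 'a set \<Rightarrow> bool" where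
  "quasiconvex G S Q \<longleftrightarrow> Q \<subseteq> carrier G \<and>
     (\<exists>\<eta>::real. \<eta> \<ge> 0 \<and>
        (\<forall>p n. cayley_geodesic G S p n \<and> p 0 \<in> Q \<and> p n \<in> Q \<longrightarrow>
           (\<forall>i\<le>n. \<exists>q\<in>Q. real (cayley_dist G S (p i) q) \<le> \<eta>)))"

definition gromov_product ::
  "('a, 'b) monoid_scheme \<Rightarrow> 'a set \<Rightarrow> 'a \<Rightarrow> 'a \<Rightarrow> 'a \<Rightarrow> real" where
  "gromov_product G S w x y =
     (real (cayley_dist G S x w) + real (cayley_dist G S y w) - real (cayley_dist G S x y)) / 2"

(* Gromov's four-point condition for the word metric. Whether it holds for some delta does
   not depend on the choice of the finite generating set S. *)
definition hyperbolic_group :: "('a, 'b) monoid_scheme \<Rightarrow> 'a set \<Rightarrow> bool" where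
  "hyperbolic_group G S \<longleftrightarrow> group G \<and> symmetrized_generating_set G S \<and>
     (\<exists>\<delta>::real. \<delta> \<ge> 0 \<and>
        (\<forall>w\<in>carrier G. \<forall>x\<in>carrier G. \<forall>y\<in>carrier G. \<forall>z\<in>carrier G.
           gromov_product G S w x z \<ge>
             min (gromov_product G S w x y) (gromov_product G S w y z) - \<delta>))"

definition elementary_group :: "('a, 'b) monoid_scheme \<Rightarrow> bool" where
  "elementary_group G \<longleftrightarrow>
     (\<exists>C. subgroup C G \<and> cyclic_group (G\<lparr>carrier := C\<rparr>) \<and> finite (rcosets\<^bsub>G\<^esub> C))"

end

theory Submission
  imports Defs
begin

text \<open>Suppose \<open>H \<subseteq> P\<^sub>1 Q\<inverse> Q P\<^sub>2\<close>. Since \<open>H\<close> is non-elementary it almost fixes no direction: there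
  is a constant \<open>N\<close> such that every \<open>w\<close> admits some \<open>z \<in> H\<close> of length at most \<open>N\<close> for which the
  Gromov product \<open>(w|zw)\<close> at \<open>1\<close> is at most \<open>N\<close>. Otherwise, translation along an almost fixed
  direction would give quasimorphisms on large balls of \<open>H\<close> with uniformly finite sublevel
  sets, and \<open>H\<close> would be virtually cyclic. For \<open>w \<in> H\<close> write
  \<open>w\<inverse> z w = a q\<^sub>1\<inverse> q\<^sub>2 b\<close> and put \<open>e = w a q\<^sub>1\<inverse>\<close>. In the triangle \<open>e, e q\<^sub>1, e q\<^sub>2\<close> the point \<open>1\<close> is
  close to the side opposite to \<open>e\<close>, hence to one of the sides \<open>[e, e q\<^sub>i]\<close>. Quasiconvexity of
  \<open>Q\<inverse>\<close> then puts \<open>e q\<^sub>i\<close>, which is \<open>w\<close> or \<open>zw\<close> up to a bounded right factor, into \<open>B Q\<close> for a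
  ball \<open>B\<close> that does not depend on \<open>w\<close>.\<close>

section \<open>Virtually cyclic groups\<close>

text \<open>Greedy descent: while \<open>\<bar>\<beta> h\<bar>\<close> exceeds
  \<open>l z + D\<close>, left multiplication by \<open>z\<close> or \<open>inv z\<close>, whichever
  has the right sign, lowers it by at least 1. One defect \<open>D\<close> is lost in passing from
  \<open>\<beta> z\<close> to \<open>\<beta> (inv z)\<close> and one in the product, hence the bound
  \<open>2 * D\<close>. The budget \<open>l h + N * l z \<le> m\<close> keeps all intermediate
  products in the ball on which \<open>\<beta>\<close> is controlled.\<close>

lemma (in group) coset_representative_small:
  fixes l :: "'a \<Rightarrow> nat" and \<beta> :: "'a \<Rightarrow> int"
  assumes z: "z \<in> carrier G" "2 * D < \<bar>\<beta> z\<bar>"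
    and l_one: "l \<one> = 0"
    and l_inv: "\<And>x. x \<in> carrier G \<Longrightarrow> l (inv x) = l x"
    and l_mult: "\<And>x y. x \<in> carrier G \<Longrightarrow> y \<in> carrier G \<Longrightarrow> l (x \<otimes> y) \<le> l x + l y"
    and quasi: "\<And>x y. x \<in> carrier G \<Longrightarrow> y \<in> carrier G \<Longrightarrow> l x \<le> m \<Longrightarrow> l y \<le> m \<Longrightarrow>
      \<bar>\<beta> (x \<otimes> y) - \<beta> x - \<beta> y\<bar> \<le> D"
    and lip: "\<And>x. x \<in> carrier G \<Longrightarrow> l x \<le> m \<Longrightarrow> \<bar>\<beta> x\<bar> \<le> int (l x)"
  shows "h \<in> carrier G \<Longrightarrow> \<bar>\<beta> h\<bar> \<le> int N \<Longrightarrow> l h + N * l z \<le> m \<Longrightarrow>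
    \<exists>c\<in>generate G {z}. l (c \<otimes> h) \<le> m \<and> \<bar>\<beta> (c \<otimes> h)\<bar> \<le> int (l z) + D"
proof (induction N arbitrary: h)
  case 0
  have "0 \<le> D" using quasi[of \<one> \<one>] l_one by simp
  with 0 show ?case by (intro bexI[of _ \<one>]) (auto intro: generate.one)
next
  case (Suc N)
  show ?case
  proof (cases "\<bar>\<beta> h\<bar> \<le> int (l z) + D")
    case True
    with Suc.prems show ?thesis by (intro bexI[of _ \<one>]) (auto intro: generate.one)
  next
    case False
    have lz: "l z \<le> m" "l h \<le> m" "l (inv z) \<le> m" using Suc.prems(3) l_inv z(1) by auto
    have one: "\<beta> \<one> = 0" using lip[of \<one>] l_one by simp
    have zi: "\<bar>\<beta> z + \<beta> (inv z)\<bar> \<le> D" using quasi[of z "inv z"] z(1) lz one by simp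
    have "\<exists>y\<in>{z, inv z}. \<bar>\<beta> (y \<otimes> h)\<bar> \<le> \<bar>\<beta> h\<bar> - 1"
    proof -
      have "\<bar>\<beta> (z \<otimes> h) - \<beta> z - \<beta> h\<bar> \<le> D" "\<bar>\<beta> (inv z \<otimes> h) - \<beta> (inv z) - \<beta> h\<bar> \<le> D"
        using quasi z(1) lz Suc.prems(1) by auto
      moreover have "\<bar>\<beta> z\<bar> \<le> int (l z)" "\<bar>\<beta> (inv z)\<bar> \<le> int (l z)"
        using lip[OF z(1)] lip[of "inv z"] lz z(1) l_inv by auto
      ultimately show ?thesis using zi z(2) False by (cases "\<beta> z > 0"; cases "\<beta> h > 0") auto
    qed
    then obtain y where y: "y \<in> {z, inv z}" "\<bar>\<beta> (y \<otimes> h)\<bar> \<le> \<bar>\<beta> h\<bar> - 1" by blast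
    have yc: "y \<in> carrier G" "y \<in> generate G {z}" "l y = l z"
      using y(1) z(1) l_inv by (auto intro: generate.incl generate.inv)
    have "l (y \<otimes> h) + N * l z \<le> m"
      using l_mult[OF yc(1) Suc.prems(1)] yc(3) Suc.prems(3) by simp
    then obtain c where c: "c \<in> generate G {z}" "l (c \<otimes> (y \<otimes> h)) \<le> m"
      "\<bar>\<beta> (c \<otimes> (y \<otimes> h))\<bar> \<le> int (l z) + D"
      using Suc.IH[of "y \<otimes> h"] Suc.prems y(2) yc(1) by auto
    moreover have "c \<in> carrier G" using c(1) generate_in_carrier[of "{z}"] z(1) by blast
    ultimately show ?thesis using generate.eng[OF c(1) yc(2)] yc(1) Suc.prems(1)
      by (intro bexI[of _ "c \<otimes> y"]) (auto simp: m_assoc)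
  qed
qed

text \<open>The map \<open>\<beta>\<close> may change with the radius \<open>m\<close>, while
  \<open>D\<close> and the counting bound \<open>M\<close> may not. Counting first yields one
  \<open>z\<close> with \<open>\<bar>\<beta> z\<bar> > 2 * D\<close> for arbitrarily large
  \<open>m\<close>. By the descent above, any finite family of cosets of the subgroup generated by
  \<open>z\<close> then has representatives in a single sublevel set, so \<open>M\<close> bounds the
  index.\<close>

lemma (in group) elementary_if_quasimorphisms:
  fixes l :: "'a \<Rightarrow> nat" and M :: "int \<Rightarrow> nat"
  assumes fin: "\<And>m. finite {x \<in> carrier G. l x \<le> m}"
    and l_one: "l \<one> = 0"
    and l_inv: "\<And>x. x \<in> carrier G \<Longrightarrow> l (inv x) = l x"
    and l_mult: "\<And>x y. x \<in> carrier G \<Longrightarrow> y \<in> carrier G \<Longrightarrow> l (x \<otimes> y) \<le> l x + l y"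
    and qm: "\<forall>m. \<exists>\<beta> :: 'a \<Rightarrow> int.
      (\<forall>x\<in>carrier G. \<forall>y\<in>carrier G. l x \<le> m \<longrightarrow> l y \<le> m \<longrightarrow>
         \<bar>\<beta> (x \<otimes> y) - \<beta> x - \<beta> y\<bar> \<le> D) \<and>
      (\<forall>x\<in>carrier G. l x \<le> m \<longrightarrow> \<bar>\<beta> x\<bar> \<le> int (l x)) \<and>
      (\<forall>K. card {x \<in> carrier G. l x \<le> m \<and> \<bar>\<beta> x\<bar> \<le> K} \<le> M K)"
  shows "elementary_group G"
proof (cases "finite (carrier G)")
  case True
  have "cyclic_group (G\<lparr>carrier := {\<one>}\<rparr>)"
    using subgroup.subgroup_is_group[OF triv_subgroup is_group]
    by (intro trivial_imp_cyclic_group) (simp add: trivial_group_def)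
  moreover have "finite (rcosets {\<one>})"
    using True by (auto simp: RCOSETS_def)
  ultimately show ?thesis
    unfolding elementary_group_def using triv_subgroup by blast
next
  case False
  from choice[OF qm] obtain \<beta> :: "nat \<Rightarrow> 'a \<Rightarrow> int" where
    quasi: "\<And>m x y. x \<in> carrier G \<Longrightarrow> y \<in> carrier G \<Longrightarrow> l x \<le> m \<Longrightarrow> l y \<le> m \<Longrightarrow>
       \<bar>\<beta> m (x \<otimes> y) - \<beta> m x - \<beta> m y\<bar> \<le> D"
    and lip: "\<And>m x. x \<in> carrier G \<Longrightarrow> l x \<le> m \<Longrightarrow> \<bar>\<beta> m x\<bar> \<le> int (l x)"
    and count: "\<And>m K. card {x \<in> carrier G. l x \<le> m \<and> \<bar>\<beta> m x\<bar> \<le> K} \<le> M K"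
    by blast
  obtain F where F: "F \<subseteq> carrier G" "finite F" "card F = Suc (M (2 * D))"
    using False infinite_arbitrarily_large by metis
  define m0 where "m0 = Max (l ` F)"
  have Fm0: "l x \<le> m0" if "x \<in> F" for x using that F(2) by (simp add: m0_def)
  have big: "\<exists>x\<in>F. 2 * D < \<bar>\<beta> m x\<bar>" if "m0 \<le> m" for m
  proof (rule ccontr)
    assume "\<not> ?thesis"
    then have "F \<subseteq> {x \<in> carrier G. l x \<le> m \<and> \<bar>\<beta> m x\<bar> \<le> 2 * D}"
      using F(1) Fm0 that by (fastforce simp: not_less)
    then have "card F \<le> card {x \<in> carrier G. l x \<le> m \<and> \<bar>\<beta> m x\<bar> \<le> 2 * D}"
      by (intro card_mono finite_subset[OF _ fin[of m]]) auto
    with count[of m "2 * D"] F(3) show False by simp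
  qed
  \<comment> \<open>Pigeonhole: each large \<open>m\<close> has a witness in the finite set
    \<open>F\<close>, so one witness serves infinitely many \<open>m\<close>.\<close>
  have "\<exists>z\<in>F. \<forall>n. \<exists>m\<ge>n. 2 * D < \<bar>\<beta> m z\<bar>"
  proof (rule ccontr)
    assume "\<not> ?thesis"
    then obtain N where N: "\<And>z m. z \<in> F \<Longrightarrow> N z \<le> m \<Longrightarrow> \<not> 2 * D < \<bar>\<beta> m z\<bar>" by metis
    define n where "n = m0 + (\<Sum>z\<in>F. N z)"
    have "N z \<le> n" if "z \<in> F" for z
      using member_le_sum[of z F N] that F(2) by (simp add: n_def)
    moreover obtain x where "x \<in> F" "2 * D < \<bar>\<beta> n x\<bar>" using big[of n] n_def by auto
    ultimately show False using N by blast
  qed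
  then obtain z where zF: "z \<in> F" and inf: "\<And>n. \<exists>m\<ge>n. 2 * D < \<bar>\<beta> m z\<bar>" by blast
  have z: "z \<in> carrier G" using zF F(1) by blast
  let ?C = "generate G {z}"
  have sub: "subgroup ?C G" using generate_is_subgroup z by simp
  have "cyclic_group (G\<lparr>carrier := ?C\<rparr>)"
    using cyclic_group_generated[of z] z by (simp add: subgroup_generated_def)
  moreover have "finite (rcosets ?C)"
  proof (rule ccontr)
    let ?K = "int (l z) + D"
    assume "infinite (rcosets ?C)"
    then obtain R where R: "R \<subseteq> rcosets ?C" "finite R" "card R = Suc (M ?K)"
      using infinite_arbitrarily_large by metis
    obtain r where r: "\<And>A. A \<in> R \<Longrightarrow> r A \<in> carrier G \<and> A = ?C #> r A"
      using R(1) by (auto simp: RCOSETS_def subset_iff) metis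
    \<comment> \<open>The sum dominates the descent budget of every representative. At most
      \<open>l (r A)\<close> descent steps are needed, because
      \<open>\<bar>\<beta> m (r A)\<bar> \<le> l (r A)\<close>.\<close>
    define n where "n = (\<Sum>A\<in>R. l (r A) + l (r A) * l z)"
    obtain m where m: "m \<ge> n" "2 * D < \<bar>\<beta> m z\<bar>" using inf by blast
    let ?T = "{x \<in> carrier G. l x \<le> m \<and> \<bar>\<beta> m x\<bar> \<le> ?K}"
    have "\<exists>g\<in>?T. A = ?C #> g" if A: "A \<in> R" for A
    proof -
      have le: "l (r A) + l (r A) * l z \<le> m"
        using member_le_sum[OF A, of "\<lambda>A. l (r A) + l (r A) * l z"] R(2) m(1) by (simp add: n_def)
      obtain c where c: "c \<in> ?C" "l (c \<otimes> r A) \<le> m" "\<bar>\<beta> m (c \<otimes> r A)\<bar> \<le> ?K"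
        using coset_representative_small[where \<beta> = "\<beta> m" and l = l and m = m and D = D
            and h = "r A" and N = "l (r A)", OF z m(2) l_one l_inv l_mult quasi lip]
          le r[OF A] lip[of "r A" m] by auto
      have cc: "c \<in> carrier G" using c(1) sub subgroup.subset by blast
      have "c \<otimes> r A \<in> ?C #> r A" using c(1) by (auto simp: r_coset_def)
      then have "A = ?C #> (c \<otimes> r A)" using repr_independence[OF _ _ sub] r[OF A] by blast
      with c cc r[OF A] show ?thesis by blast
    qed
    then have "R \<subseteq> (\<lambda>g. ?C #> g) ` ?T" by blast
    then have "card R \<le> card ?T"
      by (intro surj_card_le finite_subset[OF _ fin[of m]]) auto
    with count[of m ?K] R(3) show False by simp
  qed
  ultimately show ?thesis unfolding elementary_group_def using sub by blast
qed

section \<open>Word metrics\<close>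

locale word_metric = group G for G (structure) +
  fixes S :: "'a set"
  assumes sym_gen: "symmetrized_generating_set G S"
begin

abbreviation "E \<equiv> cayley_edges G S"
abbreviation "d \<equiv> cayley_dist G S"

lemma S_closed: "s \<in> S \<Longrightarrow> s \<in> carrier G" "s \<in> S \<Longrightarrow> inv s \<in> S"
  using sym_gen by (auto simp: symmetrized_generating_set_def)

lemma relpow_closed: "(x, y) \<in> E ^^ n \<Longrightarrow> x \<in> carrier G \<Longrightarrow> y \<in> carrier G"
  by (induction n arbitrary: y) (auto simp: cayley_edges_def S_closed)

lemma relpow_left: "(x, y) \<in> E ^^ n \<Longrightarrow> x \<in> carrier G \<Longrightarrow> g \<in> carrier G \<Longrightarrow>
  (g \<otimes> x, g \<otimes> y) \<in> E ^^ n"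
proof (induction n arbitrary: y)
  case (Suc n)
  then obtain s y' where "s \<in> S" "(x, y') \<in> E ^^ n" "y = y' \<otimes> s" "y' \<in> carrier G"
    by (auto simp: cayley_edges_def)
  moreover from this have "(g \<otimes> y', g \<otimes> y' \<otimes> s) \<in> E"
    using Suc.prems by (auto simp: cayley_edges_def)
  ultimately show ?case using Suc S_closed m_assoc by (auto intro!: relpow_Suc_I)
qed simp

lemma edge_sym: "(x, y) \<in> E \<Longrightarrow> (y, x) \<in> E"
proof -
  assume "(x, y) \<in> E"
  then obtain s where s: "s \<in> S" "x \<in> carrier G" "y = x \<otimes> s" by (auto simp: cayley_edges_def)
  then have "y \<in> carrier G" "x = y \<otimes> inv s" using S_closed by (simp_all add: m_assoc)
  then show ?thesis using S_closed(2)[OF s(1)] unfolding cayley_edges_def by blast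
qed

lemma relpow_sym: "(x, y) \<in> E ^^ n \<Longrightarrow> (y, x) \<in> E ^^ n"
  by (induction n arbitrary: y) (auto intro: edge_sym relpow_Suc_I2 simp del: relpow.simps(2) elim!: relpow_Suc_E)

lemma reach_from_one:
  assumes "x \<in> carrier G" shows "\<exists>n. (\<one>, x) \<in> E ^^ n"
proof -
  have "x \<in> generate G S" using assms sym_gen by (simp add: symmetrized_generating_set_def)
  then show ?thesis
  proof induction
    case one
    show ?case by (rule exI[of _ 0]) simp
  next
    case (incl h)
    then show ?case using S_closed by (intro exI[of _ 1]) (force simp: cayley_edges_def)
  next
    case (inv h)
    then show ?case using S_closed by (intro exI[of _ 1]) (force simp: cayley_edges_def)
  next
    case (eng h1 h2)
    then obtain a b where ab: "(\<one>, h1) \<in> E ^^ a" "(\<one>, h2) \<in> E ^^ b" by blast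
    have "h1 \<in> carrier G" using relpow_closed[OF ab(1)] by simp
    then have "(h1, h1 \<otimes> h2) \<in> E ^^ b" using relpow_left[OF ab(2), of h1] by simp
    from relpow_trans[OF ab(1) this] show ?case ..
  qed
qed

text \<open>As \<open>S\<close> generates the group, some path exists, so the \<open>LEAST\<close>
  in the definition of the distance is attained.\<close>

lemma dist_path:
  assumes "x \<in> carrier G" "y \<in> carrier G" shows "(x, y) \<in> E ^^ d x y"
proof -
  obtain n where "(\<one>, inv x \<otimes> y) \<in> E ^^ n" using reach_from_one assms by blast
  from relpow_left[OF this, of x] have "(x, y) \<in> E ^^ n"
    using assms by (simp add: m_assoc[symmetric])
  then show ?thesis unfolding cayley_dist_def by (rule LeastI)
qed

lemma dist_le: "(x, y) \<in> E ^^ n \<Longrightarrow> d x y \<le> n"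
  unfolding cayley_dist_def by (rule Least_le)

lemma dist_self [simp]: "d x x = 0"
  using dist_le[of x x 0] by simp

lemma dist_sym: "x \<in> carrier G \<Longrightarrow> y \<in> carrier G \<Longrightarrow> d x y = d y x"
  by (meson dist_le dist_path relpow_sym le_antisym)

lemma dist_triangle:
  "x \<in> carrier G \<Longrightarrow> y \<in> carrier G \<Longrightarrow> z \<in> carrier G \<Longrightarrow> d x z \<le> d x y + d y z"
  by (meson dist_le dist_path relpow_trans)

lemma dist_left_le: "g \<in> carrier G \<Longrightarrow> x \<in> carrier G \<Longrightarrow> y \<in> carrier G \<Longrightarrow>
  d (g \<otimes> x) (g \<otimes> y) \<le> d x y"
  by (meson dist_le dist_path relpow_left)

lemma dist_left: "g \<in> carrier G \<Longrightarrow> x \<in> carrier G \<Longrightarrow> y \<in> carrier G \<Longrightarrow>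
  d (g \<otimes> x) (g \<otimes> y) = d x y"
  using dist_left_le[of g x y] dist_left_le[of "inv g" "g \<otimes> x" "g \<otimes> y"]
  by (simp add: m_assoc[symmetric])

lemma dist_left_move: "g \<in> carrier G \<Longrightarrow> x \<in> carrier G \<Longrightarrow> y \<in> carrier G \<Longrightarrow>
  d (g \<otimes> x) y = d x (inv g \<otimes> y)"
  using dist_left[of g x "inv g \<otimes> y"] by (simp add: m_assoc[symmetric])

lemma dist_right: "x \<in> carrier G \<Longrightarrow> a \<in> carrier G \<Longrightarrow> d x (x \<otimes> a) = d \<one> a"
  using dist_left[of x \<one> a] by simp

lemma length_inv: "x \<in> carrier G \<Longrightarrow> d \<one> (inv x) = d \<one> x"
  using dist_left[of x \<one> "inv x"] dist_sym[of x \<one>] by simp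

lemma length_mult: "x \<in> carrier G \<Longrightarrow> y \<in> carrier G \<Longrightarrow> d \<one> (x \<otimes> y) \<le> d \<one> x + d \<one> y"
  using dist_triangle[of \<one> x "x \<otimes> y"] dist_right by simp

text \<open>In a path of minimal length every subpath is minimal, since a shortcut would contradict
  the triangle inequality.\<close>

lemma geodesic_exists:
  assumes x: "x \<in> carrier G" and y: "y \<in> carrier G"
  shows "\<exists>p. cayley_geodesic G S p (d x y) \<and> p 0 = x \<and> p (d x y) = y"
proof -
  let ?n = "d x y"
  obtain p where p: "p 0 = x" "p ?n = y" "\<And>i. i < ?n \<Longrightarrow> (p i, p (Suc i)) \<in> E"
    using dist_path[OF x y] unfolding relpow_fun_conv by blast
  have seg: "(p i, p (i + k)) \<in> E ^^ k" if "i + k \<le> ?n" for i k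
    using that by (induction k) (auto intro!: relpow_Suc_I p(3))
  have pc: "p i \<in> carrier G" if "i \<le> ?n" for i
    using seg[of 0 i] that relpow_closed x p(1) by simp
  have "d (p i) (p j) = j - i" if "i \<le> j" "j \<le> ?n" for i j
  proof -
    have "d (p i) (p j) \<le> j - i" "d x (p i) \<le> i" "d (p j) y \<le> ?n - j"
      using dist_le[OF seg[of i "j - i"]] dist_le[OF seg[of 0 i]] dist_le[OF seg[of j "?n - j"]]
        that p by auto
    moreover have "?n \<le> d x (p i) + d (p i) (p j) + d (p j) y"
      using dist_triangle[OF x pc[of j] y] dist_triangle[OF x pc[of i] pc[of j]] that by linarith
    ultimately show ?thesis using that by linarith
  qed
  with p pc show ?thesis unfolding cayley_geodesic_def by blast
qed

lemma geodesicD: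
  assumes "cayley_geodesic G S p n" "i \<le> j" "j \<le> n"
  shows "p j \<in> carrier G" "d (p i) (p j) = j - i"
  using assms by (simp_all add: cayley_geodesic_def)

lemma finite_ball: "finite {x \<in> carrier G. d \<one> x \<le> n}"
proof -
  have fin: "finite ((E ^^ k) `` {\<one>})" for k
  proof (induction k)
    case (Suc k)
    have "(E ^^ Suc k) `` {\<one>} \<subseteq> (\<lambda>(x, s). x \<otimes> s) ` ((E ^^ k) `` {\<one>} \<times> S)"
      by (force simp: cayley_edges_def)
    moreover have "finite S" using sym_gen by (simp add: symmetrized_generating_set_def)
    ultimately show ?case using Suc finite_subset by blast
  qed simp
  have "{x \<in> carrier G. d \<one> x \<le> n} \<subseteq> (\<Union>k\<le>n. (E ^^ k) `` {\<one>})"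
    using dist_path[of \<one>] by auto
  with fin show ?thesis by (meson finite_UN_I finite_atMost finite_subset)
qed

end

section \<open>Hyperbolic groups\<close>

text \<open>\<open>four_point\<close> is Gromov's inequality for the base point \<open>w\<close>,
  doubled and rearranged without subtraction. With a natural constant, later estimates become linear
  arithmetic over natural numbers.\<close>

locale hyperbolic_metric = word_metric +
  fixes D :: nat
  assumes four_point: "\<And>w x y z. \<lbrakk>w \<in> carrier G; x \<in> carrier G; y \<in> carrier G; z \<in> carrier G\<rbrakk> \<Longrightarrow>
    d x z + d w y \<le> max (d x y + d w z) (d w x + d y z) + 2 * D"
begin

section \<open>Geodesics and quasiconvex sets under the four-point condition\<close>

text \<open>Bounds on Gromov products are kept in the subtraction-free form
  \<^prop>\<open>d x g + d y g \<le> d x y + c\<close>, which says \<open>2 (x|y)\<^sub>g \<le> c\<close>.\<close>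

lemma geodesic_near:
  assumes c: "x \<in> carrier G" "y \<in> carrier G" "g \<in> carrier G"
    and geo: "cayley_geodesic G S p (d x y)" "p 0 = x" "p (d x y) = y"
    and gp: "d x g + d y g \<le> d x y + c"
  shows "\<exists>i\<le>d x y. d g (p i) \<le> c + 2 * D + 1"
proof -
  \<comment> \<open>This is the Gromov product of \<open>y\<close> and \<open>g\<close> at
    \<open>x\<close>, rounded down. It balances the two terms of the maximum in
    \<open>four_point\<close>; the rounding accounts for the \<open>+ 1\<close>.\<close>
  define i where "i = (d x g + d x y - d y g) div 2"
  have t: "d x g \<le> d x y + d y g" "d y g \<le> d x y + d x g" "d x y \<le> d x g + d y g"
    using dist_triangle[of x y g] dist_triangle[of y x g] dist_triangle[of x g y]
      dist_sym[of x y] dist_sym[of y g] c by simp_all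
  have i: "i \<le> d x y" using t i_def by linarith
  have pi: "p i \<in> carrier G" "d x (p i) = i" "d (p i) y = d x y - i"
    using geodesicD[OF geo(1), of 0 i] geodesicD[OF geo(1), of i "d x y"] i geo(2,3) by simp_all
  have "d x y + d g (p i) \<le> max (d x (p i) + d g y) (d g x + d (p i) y) + 2 * D"
    using four_point[of g x "p i" y] c pi(1) by simp
  then have "d g (p i) \<le> c + 2 * D + 1"
    using pi(2,3) i t gp dist_sym[OF c(3,2)] dist_sym[OF c(3,1)] i_def by linarith
  with i show ?thesis by blast
qed

text \<open>Quasiconvexity restated without geodesics: a small Gromov product puts \<open>g\<close>
  near a geodesic, hence near \<open>A\<close>. The constant \<open>K\<close> is uniform in the
  points and in \<open>c\<close>.\<close>

lemma quasiconvex_near: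
  assumes "quasiconvex G S A"
  shows "\<exists>K. \<forall>x\<in>A. \<forall>y\<in>A. \<forall>g\<in>carrier G. \<forall>c.
    d x g + d y g \<le> d x y + c \<longrightarrow> (\<exists>q\<in>A. d g q \<le> K + c)"
proof -
  obtain \<eta> :: real where A: "A \<subseteq> carrier G" and
    \<eta>: "\<And>p n i. cayley_geodesic G S p n \<Longrightarrow> p 0 \<in> A \<Longrightarrow> p n \<in> A \<Longrightarrow> i \<le> n \<Longrightarrow>
      \<exists>q\<in>A. real (d (p i) q) \<le> \<eta>"
    using assms unfolding quasiconvex_def by metis
  show ?thesis
  proof (intro exI[of _ "2 * D + 1 + nat \<lceil>\<eta>\<rceil>"] ballI allI impI)
    fix x y g c
    assume h: "x \<in> A" "y \<in> A" "g \<in> carrier G" "d x g + d y g \<le> d x y + c"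
    have xy: "x \<in> carrier G" "y \<in> carrier G" using h A by auto
    obtain p where p: "cayley_geodesic G S p (d x y)" "p 0 = x" "p (d x y) = y"
      using geodesic_exists xy by blast
    obtain i where i: "i \<le> d x y" "d g (p i) \<le> c + 2 * D + 1"
      using geodesic_near[OF xy h(3) p h(4)] by blast
    obtain q where q: "q \<in> A" "real (d (p i) q) \<le> \<eta>" using \<eta>[OF p(1) _ _ i(1)] p h by auto
    have "d (p i) q \<le> nat \<lceil>\<eta>\<rceil>" using q(2) by linarith
    moreover have "p i \<in> carrier G" using p(1) i(1) by (simp add: cayley_geodesic_def)
    ultimately have "d g q \<le> 2 * D + 1 + nat \<lceil>\<eta>\<rceil> + c"
      using dist_triangle[of g "p i" q] h(3) q(1) A i(2) by force
    with q(1) show "\<exists>q\<in>A. d g q \<le> 2 * D + 1 + nat \<lceil>\<eta>\<rceil> + c" by blast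
  qed
qed

section \<open>Almost fixed directions\<close>

text \<open>If every short element of \<open>H\<close> moves \<open>w\<close> to a point that looks the same from \<open>\<one>\<close>, then
  such an element \<open>z\<close> nearly translates the middle part of a geodesic from \<open>\<one>\<close> to \<open>w\<close> along
  itself; the signed translation length at a point \<open>p T\<close> of that part is a quasimorphism.\<close>

lemma almost_fixed_direction_quasimorphism:
  assumes w: "w \<in> carrier G" and H: "subgroup H G"
    and fixed: "\<And>z. z \<in> H \<Longrightarrow> d \<one> z \<le> 5 * m + D + 5 \<Longrightarrow>
      d w (z \<otimes> w) + 2 * (5 * m + D + 5) \<le> d \<one> w + d \<one> (z \<otimes> w)"
  shows "\<exists>\<beta> :: 'a \<Rightarrow> int.
      (\<forall>x\<in>H. \<forall>y\<in>H. d \<one> x \<le> m \<longrightarrow> d \<one> y \<le> m \<longrightarrow>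
         \<bar>\<beta> (x \<otimes> y) - \<beta> x - \<beta> y\<bar> \<le> 8 * int D) \<and>
      (\<forall>x\<in>H. d \<one> x \<le> m \<longrightarrow> \<bar>\<beta> x\<bar> \<le> int (d \<one> x)) \<and>
      (\<forall>K. card {x \<in> H. d \<one> x \<le> m \<and> \<bar>\<beta> x\<bar> \<le> K}
         \<le> card {x \<in> carrier G. d \<one> x \<le> 6 * D + nat K})"
proof -
  define n where "n = 5 * m + D + 5"
  define L where "L = d \<one> w"
  have HG: "z \<in> carrier G" if "z \<in> H" for z using that H subgroup.subset by blast
  \<comment> \<open>The hypothesis at \<open>z = \<one>\<close> already forces \<open>w\<close> to
    be far from \<open>\<one>\<close>.\<close>
  have Ln: "n \<le> L" using fixed[of \<one>] subgroup.one_closed[OF H] w by (simp add: L_def n_def)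
  obtain p where p: "cayley_geodesic G S p L" "p 0 = \<one>" "p L = w"
    using geodesic_exists[of \<one> w] w by (auto simp: L_def)
  have pc: "p i \<in> carrier G" if "i \<le> L" for i using p(1) that by (simp add: cayley_geodesic_def)
  have pd: "d (p i) (p j) = j - i" if "i \<le> j" "j \<le> L" for i j
    using p(1) that by (simp add: cayley_geodesic_def)
  have p1: "d \<one> (p i) = i" if "i \<le> L" for i using pd[of 0 i] that p(2) by simp
  have near: "d \<one> (z \<otimes> p i) \<le> i + d \<one> z" "i \<le> d \<one> (z \<otimes> p i) + d \<one> z"
    if "z \<in> carrier G" "i \<le> L" for z i
    using length_mult[of z "p i"] length_mult[of "inv z" "z \<otimes> p i"] that pc[of i] p1[of i]
    by (auto simp: m_assoc[symmetric] length_inv)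
  \<comment> \<open>Up to \<open>2 * D\<close>, the distance from \<open>\<one>\<close> grows at
    unit speed along the translated geodesic. The other alternative of \<open>four_point\<close>
    would give \<open>i - m \<le> m - i + 2 * D\<close>, which \<open>m + D < i\<close>
    excludes.\<close>
  have step: "d \<one> (z \<otimes> p i) + (j - i) \<le> d \<one> (z \<otimes> p j) + 2 * D"
    "d \<one> (z \<otimes> p j) \<le> d \<one> (z \<otimes> p i) + (j - i)"
    if z: "z \<in> carrier G" "d \<one> z \<le> m" and ij: "m + D < i" "i \<le> j" "j \<le> L" for z i j
  proof -
    have k: "d z (z \<otimes> p i) = i" "d z (z \<otimes> p j) = j" "d (z \<otimes> p i) (z \<otimes> p j) = j - i"
      using dist_right[OF z(1)] dist_left[OF z(1)] ij pc p1 pd by simp_all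
    have "d z (z \<otimes> p j) + d \<one> (z \<otimes> p i)
      \<le> max (d z (z \<otimes> p i) + d \<one> (z \<otimes> p j)) (d \<one> z + d (z \<otimes> p i) (z \<otimes> p j)) + 2 * D"
      by (rule four_point) (use z ij pc in auto)
    then show "d \<one> (z \<otimes> p i) + (j - i) \<le> d \<one> (z \<otimes> p j) + 2 * D"
      using k near[OF z(1), of i] z ij by auto
    show "d \<one> (z \<otimes> p j) \<le> d \<one> (z \<otimes> p i) + (j - i)"
      using dist_triangle[of \<one> "z \<otimes> p i" "z \<otimes> p j"] k(3) z ij pc by auto
  qed
  \<comment> \<open>The first use of \<open>four_point\<close> bounds the distance from
    \<open>z \<otimes> p i\<close> to \<open>w\<close>, using that \<open>w\<close> and
    \<open>z \<otimes> w\<close> stay together up to radius \<open>n\<close>; this costs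
    \<open>4 * D\<close>. The second compares with the point of \<open>p\<close> at the same
    distance from \<open>\<one>\<close>.\<close>
  have track: "d (z \<otimes> p i) (p (d \<one> (z \<otimes> p i))) \<le> 6 * D"
    if z: "z \<in> H" "d \<one> z \<le> m" and i: "m + D < i" "i + m \<le> n" for z i
  proof -
    define s where "s = d \<one> (z \<otimes> p i)"
    have zG: "z \<in> carrier G" using z HG by blast
    have iL: "i \<le> L" using i Ln by simp
    have s: "s \<le> n" "s \<le> L" using near[OF zG iL] z i Ln by (auto simp: s_def)
    have wL: "d \<one> w = L" "d (p s) w = L - s" "d (z \<otimes> p i) (z \<otimes> w) = L - i"
      using pd[of s L] pd[of i L] p(3) s iL dist_left[of z "p i" w] zG w pc by (auto simp: L_def)
    have a: "s + (L - i) \<le> d \<one> (z \<otimes> w) + 2 * D"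
      using step(1)[OF zG z(2), of i L] i iL p(3) by (simp add: s_def)
    have b: "d w (z \<otimes> w) + 2 * n \<le> L + d \<one> (z \<otimes> w)"
      using fixed[of z] z by (simp add: n_def L_def)
    have "d (z \<otimes> p i) w + d \<one> (z \<otimes> w)
      \<le> max (d (z \<otimes> p i) (z \<otimes> w) + d \<one> w) (d \<one> (z \<otimes> p i) + d (z \<otimes> w) w) + 2 * D"
      by (rule four_point) (use zG w iL pc in auto)
    then have c: "d (z \<otimes> p i) w \<le> L - s + 4 * D"
      using a b wL s iL dist_sym[of w "z \<otimes> w"] zG w unfolding s_def[symmetric] by auto
    have "d (z \<otimes> p i) (p s) + d \<one> w
      \<le> max (d (z \<otimes> p i) w + d \<one> (p s)) (d \<one> (z \<otimes> p i) + d w (p s)) + 2 * D"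
      by (rule four_point) (use zG w iL s pc in auto)
    then show ?thesis
      using c wL p1[OF s(2)] s dist_sym[of w "p s"] w pc[OF s(2)] unfolding s_def[symmetric] by auto
  qed
  \<comment> \<open>A displacement of at most \<open>m\<close> leaves the index above the threshold
    \<open>m + D\<close> required by \<open>step\<close>, and \<open>T + m\<close> is still at most
    \<open>n\<close>, as \<open>track\<close> requires.\<close>
  define T where "T = 2 * m + D + 1"
  have T: "m + D < T" "T + m \<le> n" "T + 2 * m \<le> n" "T \<le> L" "T + m \<le> L"
    using Ln by (auto simp: T_def n_def)
  define \<beta> where "\<beta> z = int (d \<one> (z \<otimes> p T)) - int T" for z
  have lip: "\<bar>\<beta> x\<bar> \<le> int (d \<one> x)" if "x \<in> H" for x
    using near[OF HG[OF that] T(4)] by (auto simp: \<beta>_def)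
  have quasi: "\<bar>\<beta> (x \<otimes> y) - \<beta> x - \<beta> y\<bar> \<le> 8 * int D"
    if x: "x \<in> H" "d \<one> x \<le> m" and y: "y \<in> H" "d \<one> y \<le> m" for x y
  proof -
    define s where "s = d \<one> (y \<otimes> p T)"
    have xG: "x \<in> carrier G" and yG: "y \<in> carrier G" using x y HG by auto
    have s: "m + D < s" "s \<le> L" using near[OF yG T(4)] y(2) T by (auto simp: s_def T_def)
    have "d (x \<otimes> (y \<otimes> p T)) (x \<otimes> p s) \<le> 6 * D"
      using track[OF y T(1,2)] dist_left xG yG pc T(4) s by (simp add: s_def)
    then have "d \<one> (x \<otimes> y \<otimes> p T) \<le> d \<one> (x \<otimes> p s) + 6 * D"
      "d \<one> (x \<otimes> p s) \<le> d \<one> (x \<otimes> y \<otimes> p T) + 6 * D"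
      using dist_triangle[of \<one> "x \<otimes> p s" "x \<otimes> y \<otimes> p T"]
        dist_triangle[of \<one> "x \<otimes> y \<otimes> p T" "x \<otimes> p s"]
        dist_sym[of "x \<otimes> p s" "x \<otimes> y \<otimes> p T"] xG yG pc[OF T(4)] pc[OF s(2)]
      by (auto simp: m_assoc)
    \<comment> \<open>Replacing \<open>y \<otimes> p T\<close> by \<open>p s\<close> cost
      \<open>6 * D\<close>; moving the base index of \<open>\<beta> x\<close> from \<open>T\<close>
      to \<open>s\<close> costs another \<open>2 * D\<close>.\<close>
    moreover have "\<bar>int (d \<one> (x \<otimes> p s)) - int s - \<beta> x\<bar> \<le> 2 * int D"
    proof (cases "T \<le> s")
      case True
      then show ?thesis using step[OF xG x(2) T(1) True s(2)] by (auto simp: \<beta>_def of_nat_diff)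
    next
      case False
      then show ?thesis using step[OF xG x(2) s(1) _ T(4)] by (auto simp: \<beta>_def of_nat_diff)
    qed
    ultimately show ?thesis unfolding \<beta>_def s_def by linarith
  qed
  have "card {x \<in> H. d \<one> x \<le> m \<and> \<bar>\<beta> x\<bar> \<le> K}
         \<le> card {x \<in> carrier G. d \<one> x \<le> 6 * D + nat K}" for K
  \<comment> \<open>Conjugation by \<open>p T\<close> turns the displacement of \<open>p T\<close>
    under \<open>x\<close> into a word length. The resulting ball depends on neither
    \<open>m\<close> nor \<open>w\<close>.\<close>
  proof (rule card_inj_on_le[where f = "\<lambda>x. inv (p T) \<otimes> (x \<otimes> p T)"])
    show "inj_on (\<lambda>x. inv (p T) \<otimes> (x \<otimes> p T)) {x \<in> H. d \<one> x \<le> m \<and> \<bar>\<beta> x\<bar> \<le> K}"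
      using pc[OF T(4)] HG by (auto intro!: inj_onI)
    have "d \<one> (inv (p T) \<otimes> (x \<otimes> p T)) \<le> 6 * D + nat K"
      if x: "x \<in> H" "d \<one> x \<le> m" "\<bar>\<beta> x\<bar> \<le> K" for x
    proof -
      define s where "s = d \<one> (x \<otimes> p T)"
      have xG: "x \<in> carrier G" using x HG by blast
      have s: "s \<le> L" using near[OF xG T(4)] x(2) T by (auto simp: s_def)
      have "d (p T) (p s) \<le> nat K"
      proof (cases "T \<le> s")
        case True
        then show ?thesis using x(3) pd[OF True s] by (auto simp: \<beta>_def s_def)
      next
        case False
        then show ?thesis using x(3) pd[of s T] T(4) dist_sym[OF pc[OF s] pc[OF T(4)]]
          by (auto simp: \<beta>_def s_def)
      qed
      moreover have "d (p s) (x \<otimes> p T) \<le> 6 * D"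
        using track[OF x(1,2) T(1,2)] dist_sym[OF pc[OF s], of "x \<otimes> p T"] xG pc[OF T(4)]
        by (simp add: s_def)
      moreover have "d (p T) (x \<otimes> p T) \<le> d (p T) (p s) + d (p s) (x \<otimes> p T)"
        by (rule dist_triangle) (use pc T(4) s xG in auto)
      ultimately show ?thesis
        using dist_left_move[of "p T" \<one> "x \<otimes> p T"] pc[OF T(4)] xG by simp
    qed
    then show "(\<lambda>x. inv (p T) \<otimes> (x \<otimes> p T)) ` {x \<in> H. d \<one> x \<le> m \<and> \<bar>\<beta> x\<bar> \<le> K}
      \<subseteq> {x \<in> carrier G. d \<one> x \<le> 6 * D + nat K}"
      using pc[OF T(4)] HG by auto
    show "finite {x \<in> carrier G. d \<one> x \<le> 6 * D + nat K}" by (rule finite_ball)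
  qed
  with lip quasi show ?thesis by blast
qed

text \<open>If no \<open>N\<close> worked, each radius \<open>m\<close> would have an almost fixed
  direction and so a quasimorphism with uniform constants, making \<open>H\<close>
  elementary.\<close>

lemma no_almost_fixed_direction:
  assumes H: "subgroup H G" and ne: "\<not> elementary_group (G\<lparr>carrier := H\<rparr>)"
  shows "\<exists>N. \<forall>w\<in>carrier G. \<exists>z\<in>H. d \<one> z \<le> N \<and> d \<one> w + d \<one> (z \<otimes> w) \<le> d w (z \<otimes> w) + N"
proof (rule ccontr)
  assume contra: "\<not> ?thesis"
  interpret K: group "G\<lparr>carrier := H\<rparr>" using H subgroup.subgroup_is_group is_group by blast
  have HG: "H \<subseteq> carrier G" using H subgroup.subset by blast
  have "elementary_group (G\<lparr>carrier := H\<rparr>)"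
  proof (rule K.elementary_if_quasimorphisms[where l = "d \<one>" and D = "8 * int D"
        and M = "\<lambda>K. card {x \<in> carrier G. d \<one> x \<le> 6 * D + nat K}"])
    show "finite {x \<in> carrier (G\<lparr>carrier := H\<rparr>). d \<one> x \<le> m}" for m
      by (rule finite_subset[OF _ finite_ball[of m]]) (use HG in auto)
    show "d \<one> \<one>\<^bsub>G\<lparr>carrier := H\<rparr>\<^esub> = 0" by simp
    show "d \<one> (inv\<^bsub>G\<lparr>carrier := H\<rparr>\<^esub> x) = d \<one> x" if "x \<in> carrier (G\<lparr>carrier := H\<rparr>)" for x
      using that HG m_inv_consistent[OF H] length_inv by auto
    show "d \<one> (x \<otimes>\<^bsub>G\<lparr>carrier := H\<rparr>\<^esub> y) \<le> d \<one> x + d \<one> y"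
      if "x \<in> carrier (G\<lparr>carrier := H\<rparr>)" "y \<in> carrier (G\<lparr>carrier := H\<rparr>)" for x y
      using that HG length_mult by auto
    show "\<forall>m. \<exists>\<beta> :: 'a \<Rightarrow> int.
      (\<forall>x\<in>carrier (G\<lparr>carrier := H\<rparr>). \<forall>y\<in>carrier (G\<lparr>carrier := H\<rparr>). d \<one> x \<le> m \<longrightarrow> d \<one> y \<le> m \<longrightarrow>
         \<bar>\<beta> (x \<otimes>\<^bsub>G\<lparr>carrier := H\<rparr>\<^esub> y) - \<beta> x - \<beta> y\<bar> \<le> 8 * int D) \<and>
      (\<forall>x\<in>carrier (G\<lparr>carrier := H\<rparr>). d \<one> x \<le> m \<longrightarrow> \<bar>\<beta> x\<bar> \<le> int (d \<one> x)) \<and>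
      (\<forall>K. card {x \<in> carrier (G\<lparr>carrier := H\<rparr>). d \<one> x \<le> m \<and> \<bar>\<beta> x\<bar> \<le> K}
         \<le> card {x \<in> carrier G. d \<one> x \<le> 6 * D + nat K})"
    proof
      fix m
      \<comment> \<open>One number \<open>N\<close> bounds both the length of \<open>z\<close> and
        twice the Gromov product, so the negation is taken at twice the radius.\<close>
      obtain w where w: "w \<in> carrier G"
        "\<And>z. z \<in> H \<Longrightarrow> d \<one> z \<le> 2 * (5 * m + D + 5) \<Longrightarrow>
          d w (z \<otimes> w) + 2 * (5 * m + D + 5) < d \<one> w + d \<one> (z \<otimes> w)"
        using contra by (meson not_le)
      have "d w (z \<otimes> w) + 2 * (5 * m + D + 5) \<le> d \<one> w + d \<one> (z \<otimes> w)"
        if "z \<in> H" "d \<one> z \<le> 5 * m + D + 5" for z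
        using w(2)[OF that(1)] that(2) by simp
      from almost_fixed_direction_quasimorphism[OF w(1) H this]
      show "\<exists>\<beta> :: 'a \<Rightarrow> int.
        (\<forall>x\<in>carrier (G\<lparr>carrier := H\<rparr>). \<forall>y\<in>carrier (G\<lparr>carrier := H\<rparr>). d \<one> x \<le> m \<longrightarrow> d \<one> y \<le> m \<longrightarrow>
           \<bar>\<beta> (x \<otimes>\<^bsub>G\<lparr>carrier := H\<rparr>\<^esub> y) - \<beta> x - \<beta> y\<bar> \<le> 8 * int D) \<and>
        (\<forall>x\<in>carrier (G\<lparr>carrier := H\<rparr>). d \<one> x \<le> m \<longrightarrow> \<bar>\<beta> x\<bar> \<le> int (d \<one> x)) \<and>
        (\<forall>K. card {x \<in> carrier (G\<lparr>carrier := H\<rparr>). d \<one> x \<le> m \<and> \<bar>\<beta> x\<bar> \<le> K}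
           \<le> card {x \<in> carrier G. d \<one> x \<le> 6 * D + nat K})"
        by simp
    qed
  qed
  with ne show False by blast
qed

section \<open>Absorbing the factor \<open>set_inv Q\<close>\<close>

text \<open>Translation by \<open>inv (e \<otimes> q)\<close> turns a geodesic from \<open>e\<close> to \<open>e \<otimes> q\<close> into one from \<open>inv q\<close>
  to \<open>\<one>\<close>, whose endpoints are in, respectively near, \<open>set_inv Q\<close>.\<close>

lemma near_suffix:
  assumes Q: "Q \<subseteq> carrier G" and qc: "quasiconvex G S (set_inv Q)"
  shows "\<exists>K. \<forall>q\<in>Q. \<forall>e\<in>carrier G. \<forall>c. d \<one> e + d \<one> (e \<otimes> q) \<le> d e (e \<otimes> q) + c \<longrightarrow>
    (\<exists>b\<in>carrier G. d \<one> b \<le> K + c \<and> (\<exists>q'\<in>Q. e \<otimes> q = b \<otimes> q'))"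
proof (cases "Q = {}")
  case False
  then obtain q0 where q0: "q0 \<in> Q" by blast
  obtain K where K: "\<And>x y g c. x \<in> set_inv Q \<Longrightarrow> y \<in> set_inv Q \<Longrightarrow> g \<in> carrier G \<Longrightarrow>
      d x g + d y g \<le> d x y + c \<Longrightarrow> \<exists>q\<in>set_inv Q. d g q \<le> K + c"
    using quasiconvex_near[OF qc] by metis
  show ?thesis
  \<comment> \<open>Since \<open>\<one>\<close> may lie outside \<open>set_inv Q\<close>, the fixed
    element \<open>inv q0\<close> replaces it as endpoint. This changes two distances by at most
    \<open>d \<one> q0\<close> each.\<close>
  proof (intro exI[of _ "K + 2 * d \<one> q0"] ballI allI impI)
    fix q e c
    assume q: "q \<in> Q" and e: "e \<in> carrier G"
      and le: "d \<one> e + d \<one> (e \<otimes> q) \<le> d e (e \<otimes> q) + c"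
    let ?g = "inv (e \<otimes> q)"
    have G: "q \<in> carrier G" "q0 \<in> carrier G" "?g \<in> carrier G" using q q0 Q e by auto
    have "d e (e \<otimes> q) = d \<one> q" using dist_right e G by simp
    also have "\<dots> = d (inv q) \<one>" using length_inv[OF G(1)] dist_sym[of \<one> "inv q"] G by simp
    also have "\<dots> \<le> d (inv q) (inv q0) + d (inv q0) \<one>"
      by (rule dist_triangle) (use G in auto)
    finally have 1: "d e (e \<otimes> q) \<le> d (inv q) (inv q0) + d \<one> q0"
      using length_inv[OF G(2)] dist_sym[of "inv q0" \<one>] G by simp
    have 2: "d (inv q) ?g = d \<one> e"
      using dist_right[of "inv q" "inv e"] length_inv[OF e] e G by (simp add: inv_mult_group)
    have "d (inv q0) ?g \<le> d (inv q0) \<one> + d \<one> ?g" by (rule dist_triangle) (use G in auto)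
    then have 3: "d (inv q0) ?g \<le> d \<one> q0 + d \<one> (e \<otimes> q)"
      using length_inv[OF G(2)] length_inv[of "e \<otimes> q"] dist_sym[of "inv q0" \<one>] G e by simp
    obtain r where r: "r \<in> set_inv Q" "d ?g r \<le> K + (2 * d \<one> q0 + c)"
      using K[of "inv q" "inv q0" ?g "2 * d \<one> q0 + c"] q q0 G 1 2 3 le
      by (auto simp: SET_INV_def)
    then obtain q' where q': "q' \<in> Q" "r = inv q'" by (auto simp: SET_INV_def)
    have q'G: "q' \<in> carrier G" using q' Q by auto
    have "d \<one> (e \<otimes> q \<otimes> inv q') \<le> K + (2 * d \<one> q0 + c)"
      using r(2) dist_left_move[of ?g \<one> "inv q'"] q' q'G G e by simp
    moreover have "e \<otimes> q = e \<otimes> q \<otimes> inv q' \<otimes> q'" using q'G G e by (simp add: m_assoc)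
    moreover have "e \<otimes> q \<otimes> inv q' \<in> carrier G" using q'G G e by simp
    ultimately show "\<exists>b\<in>carrier G. d \<one> b \<le> K + 2 * d \<one> q0 + c \<and> (\<exists>q'\<in>Q. e \<otimes> q = b \<otimes> q')"
      using q'(1) by (metis add.assoc)
  qed
qed simp

lemma subgroup_covered_by_factor:
  assumes H: "subgroup H G" and ne: "\<not> elementary_group (G\<lparr>carrier := H\<rparr>)"
    and Q: "Q \<subseteq> carrier G" and qc: "quasiconvex G S (set_inv Q)"
    and P: "finite P1" "P1 \<subseteq> carrier G" "finite P2" "P2 \<subseteq> carrier G"
    and cover: "H \<subseteq> P1 <#> set_inv Q <#> Q <#> P2"
  shows "\<exists>R1 R2. finite R1 \<and> R1 \<subseteq> carrier G \<and> finite R2 \<and> R2 \<subseteq> carrier G \<and> H \<subseteq> R1 <#> Q <#> R2"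
proof -
  have HG: "H \<subseteq> carrier G" using H subgroup.subset by blast
  obtain N where N: "\<And>w. w \<in> carrier G \<Longrightarrow> \<exists>z\<in>H. d \<one> z \<le> N \<and>
      d \<one> w + d \<one> (z \<otimes> w) \<le> d w (z \<otimes> w) + N"
    using no_almost_fixed_direction[OF H ne] by blast
  obtain K where K: "\<And>q e c. q \<in> Q \<Longrightarrow> e \<in> carrier G \<Longrightarrow>
      d \<one> e + d \<one> (e \<otimes> q) \<le> d e (e \<otimes> q) + c \<Longrightarrow>
      \<exists>b\<in>carrier G. d \<one> b \<le> K + c \<and> (\<exists>q'\<in>Q. e \<otimes> q = b \<otimes> q')"
    using near_suffix[OF Q qc] by metis
  \<comment> \<open>Inserting \<open>\<one>\<close> keeps the set under \<open>Max\<close>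
    nonempty.\<close>
  define r where "r = Max (d \<one> ` (insert \<one> (P1 \<union> P2)))"
  have r: "d \<one> a \<le> r" if "a \<in> P1 \<union> P2" for a using that P by (simp add: r_def)
  define B where "B k = {x \<in> carrier G. d \<one> x \<le> k}" for k
  \<comment> \<open>\<open>near_suffix\<close> gives a left factor of length at most
    \<open>K + N + 4 * r + 2 * D\<close>; a further \<open>N\<close> absorbs \<open>inv z\<close>.
    The right factors have length at most \<open>r\<close>.\<close>
  define k where "k = K + 2 * N + 5 * r + 2 * D"
  have "w \<in> B k <#> Q <#> B k" if w: "w \<in> H" for w
  proof -
    have wG: "w \<in> carrier G" using w HG by blast
    obtain z where z: "z \<in> H" "d \<one> z \<le> N" "d \<one> w + d \<one> (z \<otimes> w) \<le> d w (z \<otimes> w) + N"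
      using N[OF wG] by blast
    have zG: "z \<in> carrier G" using z HG by blast
    have "inv w \<otimes> (z \<otimes> w) \<in> P1 <#> set_inv Q <#> Q <#> P2"
      using cover w z(1) H by (meson subgroup.m_closed subgroup.m_inv_closed subsetD)
    then obtain a q1 q2 b where q: "a \<in> P1" "q1 \<in> Q" "q2 \<in> Q" "b \<in> P2"
      and eq: "inv w \<otimes> (z \<otimes> w) = a \<otimes> inv q1 \<otimes> q2 \<otimes> b"
      by (auto simp: set_mult_def SET_INV_def)
    have c: "a \<in> carrier G" "q1 \<in> carrier G" "q2 \<in> carrier G" "b \<in> carrier G"
      using q P Q by auto
    define e where "e = w \<otimes> a \<otimes> inv q1"
    have e: "e \<in> carrier G" using c wG by (simp add: e_def)
    have x: "e \<otimes> q1 = w \<otimes> a" using c wG by (simp add: e_def m_assoc)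
    have "z \<otimes> w = w \<otimes> (a \<otimes> inv q1 \<otimes> q2 \<otimes> b)"
      using eq wG zG by (metis inv_closed inv_solve_left m_closed)
    then have y: "e \<otimes> q2 \<otimes> b = z \<otimes> w" using c wG by (simp add: e_def m_assoc)
    then have y': "e \<otimes> q2 = z \<otimes> w \<otimes> inv b" using c e zG wG by (metis inv_solve_right m_closed)
    have ab: "d \<one> a \<le> r" "d \<one> b \<le> r" "d \<one> (inv b) \<le> r"
      using r q length_inv c by auto
    have dx: "d (e \<otimes> q1) w \<le> r" "d w (e \<otimes> q1) \<le> r"
      using dist_right[of w a] dist_sym[of w "w \<otimes> a"] x c wG ab by auto
    have dy: "d (e \<otimes> q2) (z \<otimes> w) \<le> r" "d (z \<otimes> w) (e \<otimes> q2) \<le> r"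
      using dist_right[of "z \<otimes> w" "inv b"] dist_sym[of "z \<otimes> w" "e \<otimes> q2"] y' c e wG zG ab by auto
    have "d w (z \<otimes> w) \<le> d w (e \<otimes> q1) + d (e \<otimes> q1) (e \<otimes> q2) + d (e \<otimes> q2) (z \<otimes> w)"
      using dist_triangle[of w "e \<otimes> q1" "z \<otimes> w"] dist_triangle[of "e \<otimes> q1" "e \<otimes> q2" "z \<otimes> w"]
        wG zG e c by simp
    moreover have "d \<one> (e \<otimes> q1) \<le> d \<one> w + r" "d \<one> (e \<otimes> q2) \<le> d \<one> (z \<otimes> w) + r"
      using dist_triangle[of \<one> w "e \<otimes> q1"] dist_triangle[of \<one> "z \<otimes> w" "e \<otimes> q2"]
        wG zG e c dx dy by auto
    \<comment> \<open>Moving each of the two endpoints by at most \<open>r\<close> changes the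
      doubled Gromov product by at most \<open>2 * r\<close>.\<close>
    ultimately have gp: "d \<one> (e \<otimes> q1) + d \<one> (e \<otimes> q2) \<le> d (e \<otimes> q1) (e \<otimes> q2) + (N + 4 * r)"
      using z(3) dx dy by linarith
    let ?c = "N + 4 * r + 2 * D"
    have "d (e \<otimes> q1) (e \<otimes> q2) + d \<one> e
      \<le> max (d (e \<otimes> q1) e + d \<one> (e \<otimes> q2)) (d \<one> (e \<otimes> q1) + d e (e \<otimes> q2)) + 2 * D"
      by (rule four_point) (use e c in auto)
    \<comment> \<open>The two terms of the maximum decide which side at \<open>e\<close> passes near
      \<open>\<one>\<close>.\<close>
    then consider "d \<one> e + d \<one> (e \<otimes> q1) \<le> d e (e \<otimes> q1) + ?c"
      | "d \<one> e + d \<one> (e \<otimes> q2) \<le> d e (e \<otimes> q2) + ?c"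
      using gp dist_sym[of e "e \<otimes> q1"] e c by (fastforce simp: max_def split: if_splits)
    then obtain u q v where "u \<in> B k" "q \<in> Q" "v \<in> B k" "w = u \<otimes> q \<otimes> v"
    proof cases
      case 1
      then obtain u q where u: "u \<in> carrier G" "d \<one> u \<le> K + ?c" "q \<in> Q" "e \<otimes> q1 = u \<otimes> q"
        using K[OF q(2) e] by blast
      have "w = u \<otimes> q \<otimes> inv a" using u x c wG Q by (metis inv_solve_right m_closed subsetD)
      with u c ab show ?thesis
        by (intro that[of u q "inv a"]) (auto simp: B_def k_def length_inv)
    next
      case 2
      then obtain u q where u: "u \<in> carrier G" "d \<one> u \<le> K + ?c" "q \<in> Q" "e \<otimes> q2 = u \<otimes> q"
        using K[OF q(3) e] by blast
      have qG: "q \<in> carrier G" using u Q by blast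
      \<comment> \<open>Here the covered element is \<open>z \<otimes> w\<close>; the short
        \<open>inv z\<close> is moved into the left ball.\<close>
      have "w = inv z \<otimes> (u \<otimes> q \<otimes> b)"
        using u y c wG zG qG by (metis inv_solve_left m_closed)
      then have "w = inv z \<otimes> u \<otimes> q \<otimes> b" using u c zG qG by (simp add: m_assoc)
      with u c ab show ?thesis using zG z(2) length_mult[of "inv z" u] length_inv[OF zG]
        by (intro that[of "inv z \<otimes> u" q b]) (auto simp: B_def k_def)
    qed
    then show ?thesis by (force simp: set_mult_def)
  qed
  moreover have "finite (B k)" "B k \<subseteq> carrier G" using finite_ball by (auto simp: B_def)
  ultimately show ?thesis by blast
qed

end

section \<open>Integral hyperbolicity constant and the equivalence\<close>

lemma hyperbolic_group_imp_hyperbolic_metric: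
  assumes "hyperbolic_group G S"
  shows "\<exists>D. hyperbolic_metric G S D"
proof -
  from assms obtain \<delta> :: real where g: "group G" "symmetrized_generating_set G S"
    and \<delta>: "\<And>w x y z. \<lbrakk>w \<in> carrier G; x \<in> carrier G; y \<in> carrier G; z \<in> carrier G\<rbrakk> \<Longrightarrow>
      gromov_product G S w x z \<ge> min (gromov_product G S w x y) (gromov_product G S w y z) - \<delta>"
    unfolding hyperbolic_group_def by blast
  interpret word_metric G S using g by (simp add: word_metric_def word_metric_axioms_def)
  have "hyperbolic_metric G S (nat \<lceil>\<delta>\<rceil>)"
  proof
    fix w x y z assume h: "w \<in> carrier G" "x \<in> carrier G" "y \<in> carrier G" "z \<in> carrier G"
    have s: "d x w = d w x" "d z w = d w z" "d y w = d w y" using h dist_sym by auto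
    have "real (d x z + d w y) \<le> real (max (d x y + d w z) (d w x + d y z)) + 2 * \<delta>"
      using \<delta>[OF h] unfolding gromov_product_def s
      by (auto simp: min_def max_def field_simps split: if_splits)
    then show "d x z + d w y \<le> max (d x y + d w z) (d w x + d y z) + 2 * nat \<lceil>\<delta>\<rceil>"
      by linarith
  qed
  then show ?thesis by blast
qed

theorem corollary4:
  fixes G :: "('a, 'b) monoid_scheme" (structure)
    and S Q H :: "'a set"
  assumes "hyperbolic_group G S"
    and "quasiconvex G S Q"
    and "quasiconvex G S (set_inv Q)"
    and "subgroup H G"
    and "\<not> elementary_group (G\<lparr>carrier := H\<rparr>)"
  shows "(\<forall>P\<^sub>1 P\<^sub>2. finite P\<^sub>1 \<and> P\<^sub>1 \<subseteq> carrier G \<and> finite P\<^sub>2 \<and> P\<^sub>2 \<subseteq> carrier G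
            \<longrightarrow> \<not> H \<subseteq> P\<^sub>1 <#> Q <#> P\<^sub>2)
     \<longleftrightarrow> (\<forall>P\<^sub>1 P\<^sub>2. finite P\<^sub>1 \<and> P\<^sub>1 \<subseteq> carrier G \<and> finite P\<^sub>2 \<and> P\<^sub>2 \<subseteq> carrier G
            \<longrightarrow> \<not> H \<subseteq> P\<^sub>1 <#> set_inv Q <#> Q <#> P\<^sub>2)"
proof -
  obtain D where "hyperbolic_metric G S D"
    using hyperbolic_group_imp_hyperbolic_metric assms(1) by blast
  then interpret hyperbolic_metric G S D .
  have Q: "Q \<subseteq> carrier G" using assms(2) by (simp add: quasiconvex_def)
  \<comment> \<open>The easy direction: for a fixed \<open>q\<close> in \<open>Q\<close>, each
    \<open>x\<close> in \<open>P1\<close> equals \<open>(x \<otimes> q) \<otimes> inv q\<close>.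
    Such a \<open>q\<close> exists because the covered set \<open>H\<close> contains
    \<open>\<one>\<close>.\<close>
  have trivial: "\<exists>R1. finite R1 \<and> R1 \<subseteq> carrier G \<and> H \<subseteq> R1 <#> set_inv Q <#> Q <#> P2"
    if P: "finite P1" "P1 \<subseteq> carrier G" "H \<subseteq> P1 <#> Q <#> P2" for P1 P2
  proof -
    have "Q \<noteq> {}" using P(3) subgroup.one_closed[OF assms(4)] by (auto simp: set_mult_def)
    then obtain q where q: "q \<in> Q" by blast
    have qG: "q \<in> carrier G" using q Q by blast
    have "P1 \<subseteq> (\<lambda>x. x \<otimes> q) ` P1 <#> set_inv Q"
    proof
      fix x assume x: "x \<in> P1"
      then have "x = x \<otimes> q \<otimes> inv q" using P(2) qG by (simp add: m_assoc subset_iff)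
      with x q show "x \<in> (\<lambda>x. x \<otimes> q) ` P1 <#> set_inv Q"
        unfolding set_mult_def SET_INV_def by blast
    qed
    then have "P1 <#> Q <#> P2 \<subseteq> (\<lambda>x. x \<otimes> q) ` P1 <#> set_inv Q <#> Q <#> P2"
      by (intro mono_set_mult) auto
    with P qG show ?thesis by (intro exI[of _ "(\<lambda>x. x \<otimes> q) ` P1"]) auto
  qed
  have absorb: "\<exists>R1 R2. finite R1 \<and> R1 \<subseteq> carrier G \<and> finite R2 \<and> R2 \<subseteq> carrier G \<and>
      H \<subseteq> R1 <#> Q <#> R2"
    if "finite P1" "P1 \<subseteq> carrier G" "finite P2" "P2 \<subseteq> carrier G"
      "H \<subseteq> P1 <#> set_inv Q <#> Q <#> P2" for P1 P2
    using subgroup_covered_by_factor[OF assms(4,5) Q assms(3) that] .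
  show ?thesis
  proof (intro iffI allI impI notI; elim conjE)
    fix P1 P2
    assume no: "\<forall>P\<^sub>1 P\<^sub>2. finite P\<^sub>1 \<and> P\<^sub>1 \<subseteq> carrier G \<and> finite P\<^sub>2 \<and> P\<^sub>2 \<subseteq> carrier G
            \<longrightarrow> \<not> H \<subseteq> P\<^sub>1 <#> Q <#> P\<^sub>2"
      and "finite P1" "P1 \<subseteq> carrier G" "finite P2" "P2 \<subseteq> carrier G"
        "H \<subseteq> P1 <#> set_inv Q <#> Q <#> P2"
    from absorb[OF this(2-)] no show False by blast
  next
    fix P1 P2
    assume no: "\<forall>P\<^sub>1 P\<^sub>2. finite P\<^sub>1 \<and> P\<^sub>1 \<subseteq> carrier G \<and> finite P\<^sub>2 \<and> P\<^sub>2 \<subseteq> carrier G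
            \<longrightarrow> \<not> H \<subseteq> P\<^sub>1 <#> set_inv Q <#> Q <#> P\<^sub>2"
      and P: "finite P1" "P1 \<subseteq> carrier G" "finite P2" "P2 \<subseteq> carrier G" "H \<subseteq> P1 <#> Q <#> P2"
    from trivial[OF P(1,2,5)] no P(3,4) show False by blast
  qed
qed

end
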